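(* Let $(X,d)$ be a metric space which is complete and rectifiably pathwise connected, and suppose $g:X\to X$ is a mapping for which at least one of the following holds: (a) for some $N\in\mathbb N$, the iterate $h=g^N$ satisfies: there exist $k\in(0,1)$ and a metric-preserving function $f:[0,\infty)\to[0,\infty)$ such that for each $x\in X$ there exists $\varepsilon>0$ such that for every $u\in X$, $d(x,u)<\varepsilon$ implies $f(d(h(x),h(u)))\le k\,d(x,u)$, and moreover $f'(0)>k$; or (b) for some $M\in\mathbb N$, the iterate $h=g^M$ satisfies: there exist $k\in(0,1)$ and a metric-preserving function $f:[0,\infty)\to[0,\infty)$ such that for each $x\in X$ there exists $\varepsilon>0$ such that for every $u\in X$, $d(x,u)<\varepsilon$ implies $f(d(h(x),h(u)))\le k\,d(x,u)$, and moreover there exists $c\in(0,1)$ such that $f(ct)\ge kt$ for all $t>0$ sufficiently small. Then $g$ has a unique fixed point $x_0$, and $\lim_{n\to\infty}g^n(x)=x_0$ for each $x\in X$.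
   Context: $\mathbb N$ is the set of positive integers. A function $f:[0,\infty)\to[0,\infty)$ is metric-preserving if for every metric space $(Y,\rho)$, the composition $f\circ\rho$ is a metric on $Y$. For a metric-preserving $f$, $f'(0)$ denotes the one-sided derivative $\lim_{y\to0^+}\frac{f(y)-f(0)}{y}=\lim_{y\to0^+}\frac{f(y)}{y}$ (note $f(0)=0$); it is a known fact that this limit always exists in $\mathbb R\cup\{+\infty\}$, and the value $+\infty$ is allowed. A path in $X$ is a continuous map $\gamma:[a,b]\to X$; its length is the supremum of $\sum_{i=1}^n d(\gamma(y_{i-1}),\gamma(y_i))$ over all finite partitions $a=y_0\le y_1\le\cdots\le y_n=b$; it is rectifiable if its length is finite. $X$ is rectifiably pathwise connected if every two points of $X$ can be joined by a rectifiable path. $g^n$ denotes the $n$-th iterate of $g$. *)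

theory Defs
  imports "HOL-Analysis.Analysis"
begin

text \<open>
  A function on \<open>[0,\<infinity>)\<close> is represented by a function on the reals whose values at negative
  arguments are irrelevant.  HOL cannot quantify over types inside a definition, so the test spaces
  are those with carrier in a fixed type; \<open>metric_preserving_any_type\<close> below shows that
  this gives the property for metric spaces over every type.
\<close>

definition metric_preserving :: "(real \<Rightarrow> real) \<Rightarrow> bool" where
  "metric_preserving f \<longleftrightarrow>
     (\<forall>t\<ge>0. 0 \<le> f t) \<and>
     (\<forall>(Y :: real set) \<rho>. Metric_space Y \<rho> \<longrightarrow> Metric_space Y (\<lambda>x y. f (\<rho> x y)))"

lemma metric_preserving_any_type:
  fixes Y :: "'b set"
  assumes f: "metric_preserving f" and Y: "Metric_space Y \<rho>"
  shows "Metric_space Y (\<lambda>x y. f (\<rho> x y))"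
proof -
  interpret Metric_space Y \<rho> by (rule Y)
  have transfer: "Metric_space S (\<lambda>x y. f (\<rho> x y))" if S: "finite S" "S \<subseteq> Y" for S
  proof -
    obtain \<phi> :: "'b \<Rightarrow> nat" where "inj_on \<phi> S"
      using finite_imp_inj_to_nat_seg[OF S(1)] by blast
    then have inj: "inj_on (\<lambda>x. real (\<phi> x)) S"
      by (auto simp: inj_on_def)
    define \<psi> where "\<psi> = inv_into S (\<lambda>x. real (\<phi> x))"
    have \<psi>: "\<psi> (real (\<phi> x)) = x" if "x \<in> S" for x
      unfolding \<psi>_def using inv_into_f_f[OF inj that] by simp
    let ?T = "(\<lambda>x. real (\<phi> x)) ` S"
    have "Metric_space ?T (\<lambda>a b. \<rho> (\<psi> a) (\<psi> b))"
    proof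
      show "(\<rho> (\<psi> a) (\<psi> b) = 0) = (a = b)" if "a \<in> ?T" "b \<in> ?T" for a b
        using that \<psi> S(2) zero by (metis (no_types, lifting) imageE subsetD)
      show "\<rho> (\<psi> a) (\<psi> c) \<le> \<rho> (\<psi> a) (\<psi> b) + \<rho> (\<psi> b) (\<psi> c)"
        if "a \<in> ?T" "b \<in> ?T" "c \<in> ?T" for a b c
        using that \<psi> S(2) triangle by (auto simp: subset_iff)
    qed (auto simp: commute)
    then have T: "Metric_space ?T (\<lambda>a b. f (\<rho> (\<psi> a) (\<psi> b)))"
      using f unfolding metric_preserving_def by blast
    show ?thesis
    proof
      show "0 \<le> f (\<rho> x y)" for x y
        using f by (simp add: metric_preserving_def)
      show "f (\<rho> x y) = f (\<rho> y x)" for x y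
        by (simp add: commute)
      show "(f (\<rho> x y) = 0) = (x = y)" if "x \<in> S" "y \<in> S" for x y
        using Metric_space.zero[OF T, of "real (\<phi> x)" "real (\<phi> y)"] that \<psi> inj
        by (auto simp: inj_on_def)
      show "f (\<rho> x z) \<le> f (\<rho> x y) + f (\<rho> y z)" if "x \<in> S" "y \<in> S" "z \<in> S" for x y z
        using Metric_space.triangle[OF T, of "real (\<phi> x)" "real (\<phi> y)" "real (\<phi> z)"] that \<psi>
        by auto
    qed
  qed
  show ?thesis
  proof
    show "0 \<le> f (\<rho> x y)" for x y
      using f by (simp add: metric_preserving_def)
    show "f (\<rho> x y) = f (\<rho> y x)" for x y
      by (simp add: commute)
    show "(f (\<rho> x y) = 0) = (x = y)" if "x \<in> Y" "y \<in> Y" for x y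
      using Metric_space.zero[OF transfer[of "{x, y}"], of x y] that by auto
    show "f (\<rho> x z) \<le> f (\<rho> x y) + f (\<rho> y z)" if "x \<in> Y" "y \<in> Y" "z \<in> Y" for x y z
      using Metric_space.triangle[OF transfer[of "{x, y, z}"], of x y z] that by auto
  qed
qed

definition deriv_at_0 :: "(real \<Rightarrow> real) \<Rightarrow> ereal" where
  "deriv_at_0 f = Lim (at_right 0) (\<lambda>y. ereal ((f y - f 0) / y))"

lemma metric_preserving_0:
  assumes "metric_preserving f"
  shows "f 0 = 0"
  using Metric_space.zero[OF metric_preserving_any_type[OF assms Met_TC.Metric_space_axioms],
      of "0::real" 0]
  by simp

lemma metric_preserving_triangle:
  assumes f: "metric_preserving f"
    and abc: "0 \<le> b" "0 \<le> c" "a \<le> b + c" "b \<le> a + c" "c \<le> a + b"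
  shows "f a \<le> f b + f c"
proof -
  have a0: "0 \<le> a" using abc by linarith
  have f0: "f 0 = 0" by (rule metric_preserving_0[OF f])
  have nn: "0 \<le> f t" if "0 \<le> t" for t using f that by (simp add: metric_preserving_def)
  show ?thesis
  proof (cases "a = 0 \<or> b = 0 \<or> c = 0")
    case True
    then show ?thesis
    proof (elim disjE)
      assume "a = 0" then show ?thesis using f0 nn abc by simp
    next
      assume "b = 0" then have "a = c" using abc by linarith
      then show ?thesis using nn abc by simp
    next
      assume "c = 0" then have "a = b" using abc by linarith
      then show ?thesis using nn abc by simp
    qed
  next
    case False
    define \<rho> :: "nat \<Rightarrow> nat \<Rightarrow> real" where
      "\<rho> i j = (if i = j then 0 else if i + j = 1 then b else if i + j = 3 then c else a)" for i j
    have "Metric_space {0, 1, 2} \<rho>"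
    proof
      show "0 \<le> \<rho> i j" for i j using abc a0 by (simp add: \<rho>_def)
      show "\<rho> i j = \<rho> j i" for i j by (simp add: \<rho>_def add.commute)
      show "(\<rho> i j = 0) = (i = j)" if "i \<in> {0, 1, 2}" "j \<in> {0, 1, 2}" for i j
        using False by (simp add: \<rho>_def)
      show "\<rho> i l \<le> \<rho> i j + \<rho> j l"
        if "i \<in> {0, 1, 2}" "j \<in> {0, 1, 2}" "l \<in> {0, 1, 2}" for i j l
        using that abc a0 by (elim insertE emptyE) (simp_all add: \<rho>_def)
    qed
    from Metric_space.triangle[OF metric_preserving_any_type[OF f this], of 0 1 2]
    show ?thesis by (simp add: \<rho>_def)
  qed
qed

lemma metric_preserving_polygon:
  assumes f: "metric_preserving f" and "0 \<le> a" "0 \<le> b"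
  shows "b \<le> a \<Longrightarrow> a \<le> real (Suc n) * b \<Longrightarrow> f a \<le> real (Suc n) * f b"
  using \<open>0 \<le> a\<close>
proof (induction n arbitrary: a)
  case 0
  then have "a = b" by simp
  then show ?case by simp
next
  case (Suc n)
  have nn: "0 \<le> f b" using f assms(3) by (simp add: metric_preserving_def)
  show ?case
  proof (cases "a \<le> 2 * b")
    case True
    then have "f a \<le> f b + f b"
      using metric_preserving_triangle[OF f, of b b a] Suc.prems assms(3) by auto
    also have "\<dots> \<le> real (Suc (Suc n)) * f b" using nn by (simp add: algebra_simps)
    finally show ?thesis .
  next
    case False
    then have "f (a - b) \<le> real (Suc n) * f b"
      using Suc.IH[of "a - b"] Suc.prems assms(3) by (auto simp: algebra_simps)
    moreover have "f a \<le> f (a - b) + f b"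
      using metric_preserving_triangle[OF f, of "a - b" b a] Suc.prems assms(3) by auto
    ultimately show ?thesis by (simp add: algebra_simps)
  qed
qed

lemma metric_preserving_deriv_at_0:
  assumes f: "metric_preserving f"
  shows "((\<lambda>y. ereal ((f y - f 0) / y)) \<longlongrightarrow> deriv_at_0 f) (at_right 0)"
proof -
  have f0: "f 0 = 0" by (rule metric_preserving_0[OF f])
  have nn: "0 \<le> f t" if "0 \<le> t" for t using f that by (simp add: metric_preserving_def)
  define L where "L = (SUP t\<in>{0<..}. ereal (f t / t))"
  have key: "f a / (a + b) \<le> f b / b" if ab: "0 < b" "b < a" for a b
  proof -
    define m where "m = nat \<lceil>a / b\<rceil>"
    have m1: "a / b \<le> real m" and m2: "real m < a / b + 1"
      unfolding m_def using ab by (simp_all, linarith+)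
    have "m > 0" using m1 ab by (cases m) (auto simp: field_simps)
    then obtain n where n: "m = Suc n" using gr0_implies_Suc by blast
    have "f a \<le> real m * f b"
      unfolding n by (rule metric_preserving_polygon[OF f])
        (use ab m1 n in \<open>auto simp: field_simps\<close>)
    also have "\<dots> \<le> (a / b + 1) * f b"
      using m2 nn[of b] ab by (intro mult_right_mono) auto
    finally show ?thesis using ab by (simp add: field_simps)
  qed
  have "((\<lambda>y. ereal (f y / y)) \<longlongrightarrow> L) (at_right 0)"
  proof (rule order_tendstoI)
    fix x assume "x < L"
    then obtain a where a: "0 < a" "x < ereal (f a / a)"
      unfolding L_def by (auto simp: less_SUP_iff)
    have "((\<lambda>b. f a / (a + b)) \<longlongrightarrow> f a / (a + 0)) (at_right 0)"
      using a by (intro tendsto_intros) auto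
    then have "((\<lambda>b. ereal (f a / (a + b))) \<longlongrightarrow> ereal (f a / a)) (at_right 0)"
      by simp
    then have "eventually (\<lambda>b. x < ereal (f a / (a + b))) (at_right 0)"
      using a(2) by (rule order_tendstoD(1))
    moreover have "eventually (\<lambda>b. b < a) (at_right 0)"
      using a(1) by (auto simp: eventually_at_right_field intro: exI[of _ a])
    moreover have "eventually (\<lambda>b. 0 < b) (at_right (0::real))"
      by (rule eventually_at_right_less)
    ultimately show "eventually (\<lambda>b. x < ereal (f b / b)) (at_right 0)"
    proof eventually_elim
      case (elim b)
      then show ?case using key[of b a] by (meson ereal_less_eq(3) less_le_trans)
    qed
  next
    fix x assume x: "L < x"
    have "ereal (f b / b) < x" if "0 < b" for b
      using x that unfolding L_def by (meson SUP_upper greaterThan_iff le_less_trans)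
    then show "eventually (\<lambda>b. ereal (f b / b) < x) (at_right 0)"
      using eventually_at_right_less[of "0::real"] by (auto elim: eventually_mono)
  qed
  then have lim: "((\<lambda>y. ereal ((f y - f 0) / y)) \<longlongrightarrow> L) (at_right 0)"
    by (simp add: f0)
  then have "deriv_at_0 f = L"
    unfolding deriv_at_0_def by (intro tendsto_Lim) auto
  then show ?thesis using lim by simp
qed

definition curve_length :: "real \<Rightarrow> real \<Rightarrow> (real \<Rightarrow> 'a::metric_space) \<Rightarrow> ereal" where
  "curve_length a b \<gamma> =
     (SUP (n, y) \<in> {(n :: nat, y :: nat \<Rightarrow> real).
                      y 0 = a \<and> y n = b \<and> (\<forall>i\<in>{1..n}. y (i - 1) \<le> y i)}.
        ereal (\<Sum>i=1..n. dist (\<gamma> (y (i - 1))) (\<gamma> (y i))))"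

definition rectifiably_pathwise_connected :: "'a::metric_space set \<Rightarrow> bool" where
  "rectifiably_pathwise_connected S \<longleftrightarrow>
     (\<forall>p\<in>S. \<forall>q\<in>S. \<exists>a b \<gamma>. a \<le> b \<and> continuous_on {a..b} \<gamma> \<and> \<gamma> ` {a..b} \<subseteq> S \<and>
        \<gamma> a = p \<and> \<gamma> b = q \<and> curve_length a b \<gamma> < \<infinity>)"

definition locally_radially_contractive_wrt ::
    "(real \<Rightarrow> real) \<Rightarrow> real \<Rightarrow> ('a::metric_space \<Rightarrow> 'a) \<Rightarrow> bool" where
  "locally_radially_contractive_wrt f k h \<longleftrightarrow>
     (\<forall>x. \<exists>\<epsilon>>0. \<forall>u. dist x u < \<epsilon> \<longrightarrow> f (dist (h x) (h u)) \<le> k * dist x u)"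

end

theory Submission
  imports Defs
begin

text \<open>
  Condition (b) implies condition (a), because \<open>f (c t) / (c t) \<ge> k / c\<close> for small \<open>t\<close> forces
  \<open>f'(0) \<ge> k / c > k\<close>. Under (a), \<open>f s \<ge> m s\<close> for some \<open>m > k\<close> and all small \<open>s\<close>, so the iterate \<open>h\<close>
  satisfies \<open>d (h x) (h u) \<le> (k / m) d x u\<close> for \<open>u\<close> near \<open>x\<close>. Subdividing a rectifiable path shows
  that \<open>h\<close> shrinks its length by the factor \<open>k / m\<close>; hence \<open>d (h\<^sup>n x) (h\<^sup>n y)\<close> decays
  geometrically for all \<open>x\<close>, \<open>y\<close>, and the argument of Banach's theorem applies to \<open>h\<close>.
\<close>

section \<open>Arc length\<close>

lemma curve_length_nonneg:
  assumes "a \<le> b"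
  shows "0 \<le> curve_length a b \<gamma>"
proof -
  \<comment> \<open>The supremum of an empty family would be \<open>-\<infinity>\<close>; the
    one-step partition \<open>a\<close>, \<open>b\<close> rules this out.\<close>
  let ?y = "\<lambda>i::nat. if i = 0 then a else b"
  have "0 \<le> ereal (\<Sum>i=1..1. dist (\<gamma> (?y (i - 1))) (\<gamma> (?y i)))"
    by simp
  also have "\<dots> \<le> curve_length a b \<gamma>"
    unfolding curve_length_def
    by (rule SUP_upper2[where i = "(1, ?y)"]) (use assms in auto)
  finally show ?thesis .
qed

text \<open>Appending \<open>t\<close> to a partition of the interval from \<open>a\<close> to
  \<open>s\<close> adds exactly one chord to its sum.\<close>

lemma curve_length_add_dist_le:
  assumes "a \<le> s" "s \<le> t"
  shows "curve_length a s \<gamma> + ereal (dist (\<gamma> s) (\<gamma> t)) \<le> curve_length a t \<gamma>"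
proof -
  have "ereal (\<Sum>i=1..n. dist (\<gamma> (y (i - 1))) (\<gamma> (y i)))
          \<le> curve_length a t \<gamma> - ereal (dist (\<gamma> s) (\<gamma> t))"
    if y: "y 0 = a" "y n = s" "\<forall>i\<in>{1..n}. y (i - 1) \<le> y i" for n and y :: "nat \<Rightarrow> real"
  proof -
    define z where "z i = (if i \<le> n then y i else t)" for i
    have "(\<Sum>i=1..Suc n. dist (\<gamma> (z (i - 1))) (\<gamma> (z i)))
            = (\<Sum>i=1..n. dist (\<gamma> (y (i - 1))) (\<gamma> (y i))) + dist (\<gamma> s) (\<gamma> t)"
    proof -
      have "(\<Sum>i=1..n. dist (\<gamma> (z (i - 1))) (\<gamma> (z i)))
              = (\<Sum>i=1..n. dist (\<gamma> (y (i - 1))) (\<gamma> (y i)))"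
        by (intro sum.cong) (auto simp: z_def)
      then show ?thesis
        using y(2) by (simp add: z_def)
    qed
    moreover have "ereal (\<Sum>i=1..Suc n. dist (\<gamma> (z (i - 1))) (\<gamma> (z i))) \<le> curve_length a t \<gamma>"
      unfolding curve_length_def
      by (rule SUP_upper2[where i = "(Suc n, z)"])
        (use y assms in \<open>auto simp: z_def le_Suc_eq\<close>)
    ultimately show ?thesis
      by (simp add: ereal_le_minus)
  qed
  then have "curve_length a s \<gamma> \<le> curve_length a t \<gamma> - ereal (dist (\<gamma> s) (\<gamma> t))"
    unfolding curve_length_def[of a s] by (auto intro!: SUP_least)
  then show ?thesis
    by (simp add: ereal_le_minus)
qed

text \<open>\<open>V u\<close> is the length of the arc from \<open>a\<close> to \<open>u\<close>.
  Later arguments use only this chord bound, which scales under \<open>h\<close> without computing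
  the lengths of image curves.\<close>

lemma rectifiable_arc_length_function:
  assumes "a \<le> b" and fin: "curve_length a b \<gamma> < \<infinity>"
  obtains V :: "real \<Rightarrow> real"
  where "\<And>s t. a \<le> s \<Longrightarrow> s \<le> t \<Longrightarrow> t \<le> b \<Longrightarrow> dist (\<gamma> s) (\<gamma> t) \<le> V t - V s"
proof
  fix s t assume st: "a \<le> s" "s \<le> t" "t \<le> b"
  have finite_length: "\<bar>curve_length a u \<gamma>\<bar> \<noteq> \<infinity>" if "a \<le> u" "u \<le> b" for u
  proof -
    have "curve_length a u \<gamma> \<le> curve_length a u \<gamma> + ereal (dist (\<gamma> u) (\<gamma> b))"
      by (simp add: add_increasing2)
    also have "\<dots> \<le> curve_length a b \<gamma>"
      by (rule curve_length_add_dist_le[OF that])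
    finally show ?thesis
      using fin curve_length_nonneg[OF that(1), of \<gamma>] by auto
  qed
  obtain p q where "curve_length a s \<gamma> = ereal p" "curve_length a t \<gamma> = ereal q"
    using finite_length[of s] finite_length[of t] st by (auto elim!: ereal_infinity_cases)
  \<comment> \<open>This goal instantiates \<open>V\<close>; \<open>finite_length\<close> makes the
    conversion to reals harmless.\<close>
  then show "dist (\<gamma> s) (\<gamma> t)
      \<le> real_of_ereal (curve_length a t \<gamma>) - real_of_ereal (curve_length a s \<gamma>)"
    using curve_length_add_dist_le[OF st(1,2), of \<gamma>] by simp
qed

section \<open>Local radial contractions\<close>

lemma locally_radially_contractive_id_continuous:
  assumes h: "locally_radially_contractive_wrt (\<lambda>s. s) c h" and "0 < c"
  shows "continuous_on UNIV h"
  unfolding continuous_on_iff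
proof (intro ballI allI impI)
  fix x and e :: real assume "0 < e"
  obtain \<delta> where \<delta>: "\<delta> > 0" "\<And>u. dist x u < \<delta> \<Longrightarrow> dist (h x) (h u) \<le> c * dist x u"
    using h unfolding locally_radially_contractive_wrt_def by blast
  have "dist (h u) (h x) < e" if "dist u x < min \<delta> (e / c)" for u
  proof -
    have "dist (h x) (h u) \<le> c * dist x u"
      using that \<delta>(2) by (simp add: dist_commute)
    also have "\<dots> < e"
      using that \<open>0 < c\<close> by (simp add: dist_commute field_simps)
    finally show ?thesis
      by (simp add: dist_commute)
  qed
  then show "\<exists>d>0. \<forall>u\<in>UNIV. dist u x < d \<longrightarrow> dist (h u) (h x) < e"
    using \<delta>(1) \<open>0 < c\<close> \<open>0 < e\<close> by (intro exI[of _ "min \<delta> (e / c)"]) auto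
qed

text \<open>The hypothesis controls distances from a centre only. Points on either side of a
  parameter \<open>x\<close> are therefore compared through \<open>\<gamma> x\<close>, and the
  increments of \<open>V\<close> add up without loss.\<close>

lemma locally_radially_contractive_id_path:
  fixes V :: "real \<Rightarrow> real"
  assumes h: "locally_radially_contractive_wrt (\<lambda>s. s) c h" and "0 < c"
    and \<gamma>: "continuous_on {a..b} \<gamma>"
    and V: "\<And>s t. a \<le> s \<Longrightarrow> s \<le> t \<Longrightarrow> t \<le> b \<Longrightarrow> dist (\<gamma> s) (\<gamma> t) \<le> V t - V s"
    and st: "a \<le> s" "s \<le> t" "t \<le> b"
  shows "dist (h (\<gamma> s)) (h (\<gamma> t)) \<le> c * (V t - V s)"
proof -
  \<comment> \<open>The guard is there because the small intervals in Bolzano's principle may leave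
    \<open>{a..b}\<close>, where \<open>V\<close> bounds nothing.\<close>
  let ?P = "\<lambda>u v. a \<le> u \<and> v \<le> b \<longrightarrow> dist (h (\<gamma> u)) (h (\<gamma> v)) \<le> c * (V v - V u)"
  have "?P s t"
  proof (rule Bolzano[OF st(2)])
    fix u v w assume P: "?P u v" "?P v w" "u \<le> v" "v \<le> w"
    show "?P u w"
      using P dist_triangle[of "h (\<gamma> u)" "h (\<gamma> w)" "h (\<gamma> v)"] by (auto simp: algebra_simps)
  next
    fix x assume x: "s \<le> x" "x \<le> t"
    obtain \<epsilon> where \<epsilon>: "\<epsilon> > 0" "\<And>u. dist (\<gamma> x) u < \<epsilon> \<Longrightarrow> dist (h (\<gamma> x)) (h u) \<le> c * dist (\<gamma> x) u"
      using h unfolding locally_radially_contractive_wrt_def by blast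
    obtain \<delta> where \<delta>: "\<delta> > 0"
      "\<And>u. u \<in> {a..b} \<Longrightarrow> dist u x < \<delta> \<Longrightarrow> dist (\<gamma> u) (\<gamma> x) < \<epsilon>"
      using \<gamma> \<epsilon>(1) x st unfolding continuous_on_iff by (metis atLeastAtMost_iff order_trans)
    have near: "dist (h (\<gamma> x)) (h (\<gamma> u)) \<le> c * dist (\<gamma> x) (\<gamma> u)"
      if "u \<in> {a..b}" "\<bar>u - x\<bar> < \<delta>" for u
      using \<epsilon>(2) \<delta>(2)[of u] that by (simp add: dist_commute dist_real_def)
    have "?P u v" if uv: "u \<le> x" "x \<le> v" "v - u < \<delta>" for u v
    proof
      assume ab: "a \<le> u \<and> v \<le> b"
      have "dist (h (\<gamma> u)) (h (\<gamma> v)) \<le> dist (h (\<gamma> x)) (h (\<gamma> u)) + dist (h (\<gamma> x)) (h (\<gamma> v))"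
        by (metis dist_triangle2 dist_commute)
      also have "\<dots> \<le> c * dist (\<gamma> u) (\<gamma> x) + c * dist (\<gamma> x) (\<gamma> v)"
        using near[of u] near[of v] uv ab by (simp add: dist_commute)
      also have "\<dots> \<le> c * (V x - V u) + c * (V v - V x)"
        using V[of u x] V[of x v] uv ab \<open>0 < c\<close> by (intro add_mono mult_left_mono) auto
      finally show "dist (h (\<gamma> u)) (h (\<gamma> v)) \<le> c * (V v - V u)"
        by (simp add: algebra_simps)
    qed
    then show "\<exists>d>0. \<forall>u v. u \<le> x \<and> x \<le> v \<and> v - u < d \<longrightarrow> ?P u v"
      using \<delta>(1) by blast
  qed
  then show ?thesis
    using st by simp
qed

text \<open>The image path under \<open>h ^^ n\<close> has chord bound \<open>c ^ n * V\<close>, so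
  the one-step estimate applies to it again.\<close>

lemma locally_radially_contractive_id_funpow:
  fixes V :: "real \<Rightarrow> real"
  assumes h: "locally_radially_contractive_wrt (\<lambda>s. s) c h" and "0 < c"
    and \<gamma>: "continuous_on {a..b} \<gamma>"
    and V: "\<And>s t. a \<le> s \<Longrightarrow> s \<le> t \<Longrightarrow> t \<le> b \<Longrightarrow> dist (\<gamma> s) (\<gamma> t) \<le> V t - V s"
    and st: "a \<le> s" "s \<le> t" "t \<le> b"
  shows "dist ((h ^^ n) (\<gamma> s)) ((h ^^ n) (\<gamma> t)) \<le> c ^ n * (V t - V s)"
  using st
proof (induction n arbitrary: s t)
  case 0
  then show ?case using V by simp
next
  case (Suc n)
  have "continuous_on UNIV (h ^^ n)"
  proof (induction n)
    case (Suc n)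
    then show ?case
      using continuous_on_compose2[OF locally_radially_contractive_id_continuous[OF h \<open>0 < c\<close>] Suc]
      by simp
  qed (simp add: id_def)
  then have "continuous_on {a..b} (\<lambda>u. (h ^^ n) (\<gamma> u))"
    using \<gamma> by (rule continuous_on_compose2) simp
  then have "dist (h ((h ^^ n) (\<gamma> s))) (h ((h ^^ n) (\<gamma> t))) \<le> c * (c ^ n * V t - c ^ n * V s)"
    by (rule locally_radially_contractive_id_path[OF h \<open>0 < c\<close>])
      (use Suc in \<open>auto simp: algebra_simps\<close>)
  then show ?case
    by (simp add: algebra_simps)
qed

section \<open>Geometric decay between orbits and the resulting fixed point\<close>

lemma locally_radially_contractive_id_geometric:
  fixes h :: "'a::metric_space \<Rightarrow> 'a"
  assumes conn: "rectifiably_pathwise_connected (UNIV :: 'a set)"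
    and h: "locally_radially_contractive_wrt (\<lambda>s. s) c h" and "0 < c"
  obtains K where "\<And>n. dist ((h ^^ n) x) ((h ^^ n) y) \<le> c ^ n * K"
proof -
  obtain a b \<gamma> where ab: "a \<le> b" and \<gamma>: "continuous_on {a..b} \<gamma>" "\<gamma> a = x" "\<gamma> b = y"
    and len: "curve_length a b \<gamma> < \<infinity>"
    using conn unfolding rectifiably_pathwise_connected_def by (metis UNIV_I)
  obtain V where V: "\<And>s t. a \<le> s \<Longrightarrow> s \<le> t \<Longrightarrow> t \<le> b \<Longrightarrow> dist (\<gamma> s) (\<gamma> t) \<le> V t - V s"
    using rectifiable_arc_length_function[OF ab len] by blast
  show ?thesis
    using locally_radially_contractive_id_funpow[OF h \<open>0 < c\<close> \<gamma>(1) V, of a b] ab \<gamma>(2,3)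
    by (intro that[of "V b - V a"]) auto
qed

lemma Cauchy_geometric:
  fixes X :: "nat \<Rightarrow> 'a::metric_space"
  assumes c: "0 < c" "c < 1" and X: "\<And>n. dist (X n) (X (Suc n)) \<le> c ^ n * K"
  shows "Cauchy X"
proof -
  have "0 \<le> K"
    using X[of 0] by (simp add: order_trans[OF zero_le_dist])
  \<comment> \<open>\<open>B\<close> is the sum of the series with terms \<open>c ^ i * K\<close>.
    Then \<open>c ^ n * K = (c ^ n - c ^ Suc n) * B\<close>, so the bounds telescope.\<close>
  define B where "B = K / (1 - c)"
  have K: "K = B * (1 - c)" and "0 \<le> B"
    using c \<open>0 \<le> K\<close> by (auto simp: B_def)
  have tail: "dist (X m) (X (m + j)) \<le> (c ^ m - c ^ (m + j)) * B" for m j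
  proof (induction j)
    case (Suc j)
    have "dist (X m) (X (m + Suc j)) \<le> dist (X m) (X (m + j)) + dist (X (m + j)) (X (Suc (m + j)))"
      using dist_triangle by simp
    also have "\<dots> \<le> (c ^ m - c ^ (m + j)) * B + c ^ (m + j) * K"
      by (intro add_mono Suc X)
    finally show ?case
      by (simp add: K algebra_simps)
  qed simp
  have bound: "dist (X m) (X n) \<le> c ^ m * B" if "m \<le> n" for m n
  proof -
    have "dist (X m) (X n) \<le> (c ^ m - c ^ n) * B"
      using tail[of m "n - m"] that by simp
    also have "\<dots> \<le> c ^ m * B"
      using c \<open>0 \<le> B\<close> by (intro mult_right_mono) auto
    finally show ?thesis .
  qed
  have "(\<lambda>m. c ^ m * B) \<longlonglongrightarrow> 0"
    using c by (auto intro!: tendsto_mult_left_zero LIMSEQ_power_zero)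
  show ?thesis
    unfolding Cauchy_altdef
  proof (intro allI impI)
    fix e :: real assume "0 < e"
    with \<open>(\<lambda>m. c ^ m * B) \<longlonglongrightarrow> 0\<close> have "\<forall>\<^sub>F m in sequentially. c ^ m * B < e"
      by (rule order_tendstoD)
    then obtain M where "\<And>m. m \<ge> M \<Longrightarrow> c ^ m * B < e"
      unfolding eventually_sequentially by blast
    then show "\<exists>M. \<forall>m\<ge>M. \<forall>n>m. dist (X m) (X n) < e"
      by (meson bound less_imp_le order_le_less_trans)
  qed
qed

text \<open>Completeness and decay give the limit of a single orbit; since any two orbits approach
  each other, that limit attracts every point.\<close>

lemma locally_radially_contractive_id_attracting_fixed_point:
  fixes h :: "'a::complete_space \<Rightarrow> 'a"
  assumes conn: "rectifiably_pathwise_connected (UNIV :: 'a set)"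
    and h: "locally_radially_contractive_wrt (\<lambda>s. s) c h" and c: "0 < c" "c < 1"
  obtains x0 where "h x0 = x0" "\<And>x. (\<lambda>n. (h ^^ n) x) \<longlonglongrightarrow> x0"
proof -
  have asymp: "(\<lambda>n. dist ((h ^^ n) x) ((h ^^ n) y)) \<longlonglongrightarrow> 0" for x y
  proof -
    obtain K where "\<And>n. dist ((h ^^ n) x) ((h ^^ n) y) \<le> c ^ n * K"
      using locally_radially_contractive_id_geometric[OF conn h c(1)] by blast
    moreover have "(\<lambda>n. c ^ n * K) \<longlonglongrightarrow> 0"
      using c by (auto intro!: tendsto_mult_left_zero LIMSEQ_power_zero)
    ultimately show ?thesis
      by (auto intro: tendsto_sandwich[of "\<lambda>_. 0" _ _ "\<lambda>n. c ^ n * K"])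
  qed
  fix z :: 'a
  \<comment> \<open>Comparing the orbits of \<open>z\<close> and \<open>h z\<close> bounds
    consecutive terms of one orbit.\<close>
  obtain K where "\<And>n. dist ((h ^^ n) z) ((h ^^ n) (h z)) \<le> c ^ n * K"
    using locally_radially_contractive_id_geometric[OF conn h c(1)] by blast
  then have "Cauchy (\<lambda>n. (h ^^ n) z)"
    using c by (intro Cauchy_geometric[of c _ K]) (auto simp: funpow_swap1)
  then obtain x0 where x0: "(\<lambda>n. (h ^^ n) z) \<longlonglongrightarrow> x0"
    using Cauchy_convergent_iff convergent_def by blast
  have "isCont h x0"
    using locally_radially_contractive_id_continuous[OF h c(1)]
    by (simp add: continuous_on_eq_continuous_at)
  then have "(\<lambda>n. h ((h ^^ n) z)) \<longlonglongrightarrow> h x0"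
    using x0 by (rule isCont_tendsto_compose)
  moreover have "(\<lambda>n. h ((h ^^ n) z)) \<longlonglongrightarrow> x0"
    using LIMSEQ_Suc[OF x0] by simp
  ultimately have fixed: "h x0 = x0"
    by (rule LIMSEQ_unique)
  have "(\<lambda>n. (h ^^ n) x) \<longlonglongrightarrow> x0" for x
  proof -
    have "(h ^^ n) x0 = x0" for n
      by (induction n) (simp_all add: fixed)
    then show ?thesis
      using asymp[of x x0] by (subst tendsto_dist_iff) simp
  qed
  then show ?thesis
    using that fixed by blast
qed

section \<open>From an iterate back to the map\<close>

text \<open>Since \<open>g\<close> commutes with \<open>g ^^ N\<close>, the point
  \<open>g x0\<close> is also fixed by \<open>g ^^ N\<close>, and attraction identifies it with
  \<open>x0\<close>. The orbit of \<open>x\<close> under \<open>g\<close> splits by residues modulo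
  \<open>N\<close> into \<open>N\<close> orbits of \<open>g ^^ N\<close>.\<close>

lemma funpow_attracting_fixed_point:
  fixes g :: "'a::metric_space \<Rightarrow> 'a"
  assumes N: "N \<ge> 1" and fixed: "(g ^^ N) x0 = x0"
    and lim: "\<And>x. (\<lambda>n. ((g ^^ N) ^^ n) x) \<longlonglongrightarrow> x0"
  shows "g x0 = x0" and "(\<lambda>n. (g ^^ n) x) \<longlonglongrightarrow> x0"
proof -
  have "((g ^^ N) ^^ n) (g x0) = g x0" for n
  proof (induction n)
    case (Suc n)
    then show ?case
      using fixed by (simp add: funpow_swap1[symmetric])
  qed simp
  then show "g x0 = x0"
    using lim[of "g x0"] by (simp add: LIMSEQ_const_iff)
  show "(\<lambda>n. (g ^^ n) x) \<longlonglongrightarrow> x0"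
    unfolding lim_sequentially
  proof (intro allI impI)
    fix e :: real assume "0 < e"
    \<comment> \<open>There are finitely many residues, so one threshold serves them all.\<close>
    have "\<forall>\<^sub>F n in sequentially. \<forall>r\<in>{..<N}. dist (((g ^^ N) ^^ n) ((g ^^ r) x)) x0 < e"
      by (intro eventually_ball_finite ballI tendstoD lim \<open>0 < e\<close>) simp
    then obtain M where
      M: "\<And>n r. n \<ge> M \<Longrightarrow> r < N \<Longrightarrow> dist (((g ^^ N) ^^ n) ((g ^^ r) x)) x0 < e"
      unfolding eventually_sequentially by auto
    have "dist ((g ^^ n) x) x0 < e" if "n \<ge> M * N" for n
    proof -
      have "(g ^^ n) x = ((g ^^ N) ^^ (n div N)) ((g ^^ (n mod N)) x)"
        by (metis comp_apply funpow_add funpow_mult mult_div_mod_eq)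
      moreover have "n div N \<ge> M"
        using that N by (metis div_le_mono div_mult_self_is_m less_le_trans zero_less_one)
      ultimately show ?thesis
        using M N by simp
    qed
    then show "\<exists>no. \<forall>n\<ge>no. dist ((g ^^ n) x) x0 < e"
      by blast
  qed
qed

section \<open>Metric-preserving gauges\<close>

text \<open>A metric-preserving function need not be monotone or continuous at 0, yet small values force
  small arguments.\<close>

lemma metric_preserving_small_arg:
  assumes f: "metric_preserving f" and "0 < a" "0 \<le> s" "f s < f a / 2"
  shows "s < a"
proof (rule ccontr)
  assume "\<not> s < a"
  \<comment> \<open>When \<open>a \<le> s\<close>, the numbers \<open>s\<close>, \<open>s\<close>,
    \<open>a\<close> are the sides of an isosceles triangle.\<close>
  then have "f a \<le> f s + f s"
    using metric_preserving_triangle[OF f, of s s a] assms by auto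
  then show False
    using assms(4) by simp
qed

lemma metric_preserving_pos:
  assumes f: "metric_preserving f" and "0 < a"
  shows "0 < f a"
proof -
  have "Metric_space (UNIV :: real set) (\<lambda>x y. f (dist x y))"
    by (rule metric_preserving_any_type[OF f Met_TC.Metric_space_axioms])
  from Metric_space.zero[OF this, of 0 a] have "f a \<noteq> 0"
    using \<open>0 < a\<close> by simp
  moreover have "0 \<le> f a"
    using f \<open>0 < a\<close> by (simp add: metric_preserving_def)
  ultimately show ?thesis
    by simp
qed

lemma deriv_at_0_gt_of_scaled_lower_bound:
  assumes f: "metric_preserving f" and k: "0 < k" and c: "0 < c" "c < 1"
    and ev: "\<forall>\<^sub>F t in at_right 0. f (c * t) \<ge> k * t"
  shows "deriv_at_0 f > ereal k"
proof -
  obtain b where b: "b > 0" "\<And>t. 0 < t \<Longrightarrow> t < b \<Longrightarrow> k * t \<le> f (c * t)"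
    using ev unfolding eventually_at_right_field by blast
  \<comment> \<open>Substitute \<open>t = y / c\<close>; the range \<open>y < c * b\<close> is
    exactly \<open>t < b\<close>.\<close>
  have "ereal (k / c) \<le> ereal ((f y - f 0) / y)" if "0 < y" "y < c * b" for y
    using b(2)[of "y / c"] that c by (simp add: metric_preserving_0[OF f] field_simps)
  then have "\<forall>\<^sub>F y in at_right 0. ereal (k / c) \<le> ereal ((f y - f 0) / y)"
    unfolding eventually_at_right_field using b(1) c by (intro exI[of _ "c * b"]) auto
  then have "ereal (k / c) \<le> deriv_at_0 f"
    using metric_preserving_deriv_at_0[OF f] by (intro tendsto_lowerbound) auto
  moreover have "k < k / c"
    using k c by (simp add: field_simps)
  ultimately show ?thesis
    by (metis less_ereal.simps(1) less_le_trans)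
qed

lemma locally_radially_contractive_wrt_imp_id:
  assumes f: "metric_preserving f" and k: "0 < k" and deriv: "deriv_at_0 f > ereal k"
    and h: "locally_radially_contractive_wrt f k h"
  obtains c where "0 < c" "c < 1" "locally_radially_contractive_wrt (\<lambda>s. s) c h"
proof -
  \<comment> \<open>A real \<open>m\<close> strictly above \<open>k\<close> makes
    \<open>k / m < 1\<close> and also covers an infinite derivative.\<close>
  obtain m where m: "k < m" "ereal m < deriv_at_0 f"
    using ereal_dense2[OF deriv] by auto
  from metric_preserving_deriv_at_0[OF f] m(2)
  have "\<forall>\<^sub>F y in at_right 0. ereal m < ereal ((f y - f 0) / y)"
    by (rule order_tendstoD)
  then obtain b where b: "b > 0" "\<And>y. 0 < y \<Longrightarrow> y < b \<Longrightarrow> m < f y / y"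
    unfolding eventually_at_right_field by (auto simp: metric_preserving_0[OF f])
  have lower: "m * y \<le> f y" if "0 \<le> y" "y < b" for y
    using b(2)[of y] that by (cases "y = 0") (auto simp: metric_preserving_0[OF f] field_simps)
  have "locally_radially_contractive_wrt (\<lambda>s. s) (k / m) h"
    unfolding locally_radially_contractive_wrt_def
  proof
    fix x
    obtain \<epsilon> where \<epsilon>: "\<epsilon> > 0" "\<And>u. dist x u < \<epsilon> \<Longrightarrow> f (dist (h x) (h u)) \<le> k * dist x u"
      using h unfolding locally_radially_contractive_wrt_def by blast
    \<comment> \<open>The second bound keeps \<open>k * dist x u\<close> below
      \<open>f b / 2\<close>. This forces the image distance below \<open>b\<close>, where
      \<open>f\<close> dominates the line of slope \<open>m\<close>.\<close>
    define \<delta> where "\<delta> = min \<epsilon> (f b / (2 * k))"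
    have "\<delta> > 0"
      using \<epsilon>(1) k metric_preserving_pos[OF f b(1)] by (simp add: \<delta>_def)
    moreover have "dist (h x) (h u) \<le> k / m * dist x u" if "dist x u < \<delta>" for u
    proof -
      have le: "f (dist (h x) (h u)) \<le> k * dist x u"
        using \<epsilon>(2) that by (simp add: \<delta>_def)
      also have "\<dots> < f b / 2"
        using that k by (simp add: \<delta>_def field_simps)
      finally have "dist (h x) (h u) < b"
        by (intro metric_preserving_small_arg[OF f b(1)]) auto
      then have "m * dist (h x) (h u) \<le> k * dist x u"
        using lower[of "dist (h x) (h u)"] le by simp
      then show ?thesis
        using k m(1) by (simp add: field_simps)
    qed
    ultimately show "\<exists>\<epsilon>>0. \<forall>u. dist x u < \<epsilon> \<longrightarrow> dist (h x) (h u) \<le> k / m * dist x u"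
      by blast
  qed
  then show ?thesis
    using k m(1) by (intro that[of "k / m"]) auto
qed

theorem theorem26:
  fixes g :: "'a::complete_space \<Rightarrow> 'a"
  assumes "rectifiably_pathwise_connected (UNIV :: 'a set)"
    and "(\<exists>N\<ge>1. \<exists>k f. 0 < k \<and> k < 1 \<and> metric_preserving f \<and>
            locally_radially_contractive_wrt f k (g ^^ N) \<and>
            deriv_at_0 f > ereal k) \<or>
         (\<exists>M\<ge>1. \<exists>k f. 0 < k \<and> k < 1 \<and> metric_preserving f \<and>
            locally_radially_contractive_wrt f k (g ^^ M) \<and>
            (\<exists>c. 0 < c \<and> c < 1 \<and> (\<forall>\<^sub>F t in at_right 0. f (c * t) \<ge> k * t)))"
  shows "\<exists>x0. g x0 = x0 \<and> (\<forall>x. g x = x \<longrightarrow> x = x0) \<and>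
              (\<forall>x. (\<lambda>n. (g ^^ n) x) \<longlonglongrightarrow> x0)"
proof -
  \<comment> \<open>Both alternatives merge here into the derivative condition.\<close>
  obtain N k f where N: "N \<ge> 1" and k: "0 < k" and f: "metric_preserving f"
    and h: "locally_radially_contractive_wrt f k (g ^^ N)" and deriv: "deriv_at_0 f > ereal k"
    using assms(2) deriv_at_0_gt_of_scaled_lower_bound by metis
  obtain c where "0 < c" "c < 1" "locally_radially_contractive_wrt (\<lambda>s. s) c (g ^^ N)"
    using locally_radially_contractive_wrt_imp_id[OF f k deriv h] by blast
  then obtain x0 where "(g ^^ N) x0 = x0" "\<And>x. (\<lambda>n. ((g ^^ N) ^^ n) x) \<longlonglongrightarrow> x0"
    using locally_radially_contractive_id_attracting_fixed_point[OF assms(1)] by blast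
  note x0 = funpow_attracting_fixed_point[OF N this]
  \<comment> \<open>The orbit of a fixed point is constant, yet it converges to
    \<open>x0\<close>.\<close>
  have "x = x0" if "g x = x" for x
  proof -
    have "(g ^^ n) x = x" for n
      by (induction n) (simp_all add: that)
    then show ?thesis
      using x0(2)[of x] by (simp add: LIMSEQ_const_iff)
  qed
  with x0 show ?thesis
    by blast
qed

end
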